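(* We have $$\sum_{n=1}^\infty\big(q^{n^2-1}-q^{5n^2-1}\big)=\frac{(q^4,q^6,q^{10};q^{10})_\infty\,(q^2,q^{18};q^{20})_\infty}{(q^2,q^3;q^5)_\infty}.$$
   Context: Here $q$ is a complex number with $|q|<1$ (equivalently, the identity may be read as an identity of formal power series in $q$). For a complex number $a$, $(a;q)_\infty:=\prod_{i=0}^\infty(1-aq^i)$, and $(a_1,a_2,\dots,a_m;q)_\infty:=\prod_{j=1}^m(a_j;q)_\infty$. *)

theory Defs
  imports "HOL-Analysis.Analysis"
begin

definition qpoch_inf :: "complex \<Rightarrow> complex \<Rightarrow> complex" where
  "qpoch_inf a q = (\<Prod>i. 1 - a * q ^ i)"

definition qpochs_inf :: "complex list \<Rightarrow> complex \<Rightarrow> complex" where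
  "qpochs_inf as q = (\<Prod>a\<leftarrow>as. qpoch_inf a q)"

text \<open>For \<open>|q| < 1\<close> the product converges, so the value of \<open>\<Prod>i\<close> is never a default value.\<close>

lemma qpoch_inf_has_prod:
  assumes "norm q < 1"
  shows "(\<lambda>i. 1 - a * q ^ i) has_prod qpoch_inf a q"
proof -
  have "summable (\<lambda>i. norm a * norm q ^ i)"
    using assms by (intro summable_mult summable_geometric) simp
  then have "abs_convergent_prod (\<lambda>i. 1 - a * q ^ i)"
    by (simp add: abs_convergent_prod_conv_summable norm_mult norm_power)
  then show ?thesis
    unfolding qpoch_inf_def
    by (intro convergent_prod_has_prod abs_convergent_prod_imp_convergent_prod)
qed

end

theory Submission
  imports Defs
begin

text \<open>
  With \<open>G(q) = 1/(q,q\<^sup>4;q\<^sup>5)\<^sub>\<infinity>\<close>, \<open>H(q) = 1/(q\<^sup>2,q\<^sup>3;q\<^sup>5)\<^sub>\<infinity>\<close> and \<open>\<phi>(q) = \<Sum>n\<in>\<int>. q^(n\<^sup>2)\<close>,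
  put \<open>A = (q\<^sup>2;q\<^sup>2)\<^sub>\<infinity> G(q) G(q\<^sup>4)\<close> and \<open>B = q (q\<^sup>2;q\<^sup>2)\<^sub>\<infinity> H(q) H(q\<^sup>4)\<close>. The right-hand side of the
  theorem is \<open>B/q\<close> and the left-hand side is \<open>(\<phi>(q) - \<phi>(q\<^sup>5))/(2q)\<close>, so two of Ramanujan's forty
  identities suffice: \<open>A + B = \<phi>(q)\<close> and \<open>A - B = \<phi>(q\<^sup>5)\<close>. By the Jacobi triple product, the first is
  an identity of double theta series, as is \<open>4AB = \<phi>(q)\<^sup>2 - \<phi>(q\<^sup>5)\<^sup>2\<close>; both follow by splitting the
  lattice \<open>\<int>\<^sup>2\<close> into cosets of a sublattice of index 5. Together they give \<open>(A - B)\<^sup>2 = \<phi>(q\<^sup>5)\<^sup>2\<close>.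
  As \<open>\<phi>(q\<^sup>5)\<close> has no zero in the unit disc, \<open>(A - B)/\<phi>(q\<^sup>5)\<close> is continuous there with values \<open>\<plusminus>1\<close>,
  hence equal to its value \<open>1\<close> at the origin.
\<close>

section \<open>The infinite q-Pochhammer symbol\<close>

lemma norm_power_less_1: "norm (q :: complex) < 1 \<Longrightarrow> k > 0 \<Longrightarrow> norm (q ^ k) < 1"
  by (simp add: norm_power power_less_one_iff)

lemma qpoch_inf_LIMSEQ:
  assumes "norm q < 1"
  shows "(\<lambda>n. \<Prod>i<n. 1 - a * q ^ i) \<longlonglongrightarrow> qpoch_inf a q"
  using has_prod_imp_tendsto'[OF qpoch_inf_has_prod[OF assms]] .

lemma qpoch_inf_eqI:
  assumes "norm q < 1" "(\<lambda>n. \<Prod>i<n. 1 - a * q ^ i) \<longlonglongrightarrow> c"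
  shows "qpoch_inf a q = c"
  using qpoch_inf_LIMSEQ[OF assms(1)] assms(2) LIMSEQ_unique by blast

lemma qpoch_inf_nonzero:
  assumes "norm q < 1" "norm a < 1"
  shows "qpoch_inf a q \<noteq> 0"
proof -
  have "1 - a * q ^ i \<noteq> 0" for i
  proof
    assume "1 - a * q ^ i = 0"
    then have "norm (a * q ^ i) = 1" by (metis eq_iff_diff_eq_0 norm_one)
    moreover have "norm (a * q ^ i) \<le> norm a * 1"
      unfolding norm_mult norm_power using assms
      by (intro mult_left_mono power_le_one) auto
    ultimately show False using assms by simp
  qed
  then show ?thesis
    using has_prod_eq_0_iff[OF qpoch_inf_has_prod[OF assms(1), of a]] by auto
qed

text \<open>The factors are grouped by the residue of their index modulo \<open>k\<close>. This is
  harmless because the partial products of length \<open>n * k\<close> form a subsequence of a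
  convergent sequence.\<close>

lemma qpoch_inf_split:
  assumes "norm q < 1" "k > 0"
  shows "qpoch_inf a q = (\<Prod>j<k. qpoch_inf (a * q ^ j) (q ^ k))"
proof (rule qpoch_inf_eqI[OF assms(1)])
  have qk: "norm (q ^ k) < 1" using assms by (rule norm_power_less_1)
  have "(\<lambda>n. \<Prod>j<k. \<Prod>i<n. 1 - a * q ^ j * (q ^ k) ^ i) \<longlonglongrightarrow> (\<Prod>j<k. qpoch_inf (a * q ^ j) (q ^ k))"
    by (intro tendsto_prod qpoch_inf_LIMSEQ qk)
  moreover have "(\<Prod>j<k. \<Prod>i<n. 1 - a * q ^ j * (q ^ k) ^ i) = (\<Prod>i<n * k. 1 - a * q ^ i)" for n
  proof -
    have "(\<Prod>i<n * k. 1 - a * q ^ i) = (\<Prod>m<n. \<Prod>i\<in>{m*k..<m*k+k}. 1 - a * q ^ i)"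
      by (simp add: prod.nat_group)
    also have "\<dots> = (\<Prod>m<n. \<Prod>j<k. 1 - a * q ^ j * (q ^ k) ^ m)"
    proof (rule prod.cong[OF refl])
      fix m
      have "(\<Prod>i\<in>{m*k..<m*k+k}. 1 - a * q ^ i) = (\<Prod>j\<in>{0..<k}. 1 - a * q ^ (j + m*k))"
        using prod.shift_bounds_nat_ivl[of "\<lambda>i. 1 - a * q ^ i" 0 "m*k" k] by (simp add: add.commute)
      then show "(\<Prod>i\<in>{m*k..<m*k+k}. 1 - a * q ^ i) = (\<Prod>j<k. 1 - a * q ^ j * (q ^ k) ^ m)"
        by (simp add: power_add power_mult [symmetric] mult.commute mult.assoc lessThan_atLeast0)
    qed
    also have "\<dots> = (\<Prod>j<k. \<Prod>i<n. 1 - a * q ^ j * (q ^ k) ^ i)"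
      by (rule prod.swap)
    finally show ?thesis ..
  qed
  ultimately have lim: "(\<lambda>n. \<Prod>i<n * k. 1 - a * q ^ i) \<longlonglongrightarrow> (\<Prod>j<k. qpoch_inf (a * q ^ j) (q ^ k))"
    by simp
  have "strict_mono (\<lambda>n. n * k)"
    using assms(2) by (simp add: strict_mono_def)
  from LIMSEQ_subseq_LIMSEQ[OF qpoch_inf_LIMSEQ[OF assms(1), of a] this]
  have "(\<lambda>n. \<Prod>i<n * k. 1 - a * q ^ i) \<longlonglongrightarrow> qpoch_inf a q"
    by (simp add: o_def)
  with lim have "qpoch_inf a q = (\<Prod>j<k. qpoch_inf (a * q ^ j) (q ^ k))"
    using LIMSEQ_unique by blast
  then show "(\<lambda>n. \<Prod>i<n. 1 - a * q ^ i) \<longlonglongrightarrow> (\<Prod>j<k. qpoch_inf (a * q ^ j) (q ^ k))"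
    using qpoch_inf_LIMSEQ[OF assms(1), of a] by simp
qed

lemma qpoch_inf_mult_uminus:
  assumes "norm q < 1"
  shows "qpoch_inf a q * qpoch_inf (- a) q = qpoch_inf (a\<^sup>2) (q\<^sup>2)"
proof (rule qpoch_inf_eqI[symmetric])
  show "norm (q\<^sup>2) < 1"
    using assms by (simp add: norm_power power_less_one_iff)
  have "(\<lambda>n. (\<Prod>i<n. 1 - a * q ^ i) * (\<Prod>i<n. 1 - (- a) * q ^ i)) \<longlonglongrightarrow> qpoch_inf a q * qpoch_inf (- a) q"
    by (intro tendsto_mult qpoch_inf_LIMSEQ assms)
  moreover have "(\<Prod>i<n. 1 - a * q ^ i) * (\<Prod>i<n. 1 - (- a) * q ^ i) = (\<Prod>i<n. 1 - a\<^sup>2 * (q\<^sup>2) ^ i)" for n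
    unfolding prod.distrib[symmetric]
    by (intro prod.cong refl) (simp add: algebra_simps power2_eq_square power_mult_distrib)
  ultimately show "(\<lambda>n. \<Prod>i<n. 1 - a\<^sup>2 * (q\<^sup>2) ^ i) \<longlonglongrightarrow> qpoch_inf a q * qpoch_inf (- a) q"
    by simp
qed

text \<open>On every closed disc of radius \<open>r < 1\<close> the partial products converge
  uniformly, by the Weierstrass M-test with majorant \<open>norm c * (r ^ b) ^ n\<close>. The
  continuity is what later fixes a sign on the whole disc.\<close>

lemma continuous_on_qpoch_inf:
  assumes "b > 0"
  shows "continuous_on (ball 0 1) (\<lambda>q. qpoch_inf (c * q ^ a) (q ^ b))"
proof -
  have "continuous_on (cball 0 r) (\<lambda>q. qpoch_inf (c * q ^ a) (q ^ b))" if r: "0 < r" "r < 1" for r :: real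
  proof -
    let ?f = "\<lambda>n q. 1 - c * q ^ a * (q ^ b) ^ n"
    have bound: "norm (?f n q - 1) \<le> norm c * (r ^ b) ^ n" if "q \<in> cball 0 r" for n and q :: complex
    proof -
      have q: "norm q \<le> r" using that by simp
      have "norm q ^ a \<le> 1" using q r by (intro power_le_one) auto
      moreover have "(norm q ^ b) ^ n \<le> (r ^ b) ^ n" using q by (intro power_mono) auto
      ultimately have "norm c * norm q ^ a * (norm q ^ b) ^ n \<le> norm c * 1 * (r ^ b) ^ n"
        using r by (intro mult_mono mult_left_mono) auto
      then show ?thesis by (simp add: norm_mult norm_power)
    qed
    have "summable (\<lambda>n. norm c * (r ^ b) ^ n)"
      using r assms by (intro summable_mult summable_geometric) (simp add: power_less_one_iff)
    then have "uniformly_convergent_on (cball 0 r) (\<lambda>N q. \<Sum>n<N. norm (?f n q - 1))"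
      by (rule Weierstrass_m_test'[rotated]) (use bound in auto)
    then have "uniformly_convergent_on (cball 0 r) (\<lambda>N q. \<Prod>n<N. ?f n q)"
      by (intro uniformly_convergent_on_prod') (auto intro!: continuous_intros)
    then obtain l where l: "uniform_limit (cball 0 r) (\<lambda>N q. \<Prod>n<N. ?f n q) l sequentially"
      by (auto simp: uniformly_convergent_on_def)
    have "continuous_on (cball 0 r) l"
      by (rule uniform_limit_theorem[OF _ l]) (auto intro!: always_eventually continuous_intros)
    moreover have "l q = qpoch_inf (c * q ^ a) (q ^ b)" if "q \<in> cball 0 r" for q
    proof (rule qpoch_inf_eqI[symmetric])
      show "norm (q ^ b) < 1" using that r assms by (simp add: norm_power power_less_one_iff)
      show "(\<lambda>N. \<Prod>n<N. ?f n q) \<longlonglongrightarrow> l q"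
        by (rule tendsto_uniform_limitI[OF l that])
    qed
    ultimately show ?thesis by (rule continuous_on_eq)
  qed
  then have cont: "continuous_on (ball 0 r) (\<lambda>q. qpoch_inf (c * q ^ a) (q ^ b))" if "0 < r" "r < 1" for r
    by (rule continuous_on_subset[OF _ ball_subset_cball]) (use that in simp_all)
  show ?thesis
  proof (rule continuous_at_imp_continuous_on, rule ballI)
    fix q :: complex assume "q \<in> ball 0 1"
    then have "norm q < 1" by simp
    then obtain r where r: "norm q < r" "r < 1" using dense by blast
    moreover have "0 < r" using r norm_ge_zero[of q] by linarith
    ultimately show "isCont (\<lambda>q. qpoch_inf (c * q ^ a) (q ^ b)) q"
      using cont[of r] by (simp add: continuous_on_eq_continuous_at)
  qed
qed

section \<open>The Jacobi triple product\<close>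

text \<open>The general term of Ramanujan's theta function f(a, b) at a = w, b = q/w. With
  \<open>w = q\<close> and base \<open>q^2\<close> in place of \<open>q\<close> the exponent becomes
  n^2.\<close>

definition theta_term :: "complex \<Rightarrow> complex \<Rightarrow> int \<Rightarrow> complex" where
  "theta_term w q n = w powi n * q powi (n * (n - 1) div 2)"

definition theta :: "complex \<Rightarrow> complex \<Rightarrow> complex" where
  "theta w q = infsum (theta_term w q) UNIV"

lemma theta_term_0 [simp]: "theta_term w q 0 = 1"
  by (simp add: theta_term_def)

lemma theta_term_Suc:
  assumes "w \<noteq> 0" "q \<noteq> 0"
  shows "theta_term w q (n + 1) = w * q powi n * theta_term w q n"
proof -
  have "(n + 1) * (n + 1 - 1) = n * (n - 1) + n * 2" by (simp add: algebra_simps)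
  then have "(n + 1) * (n + 1 - 1) div 2 = n * (n - 1) div 2 + n" by simp
  then show ?thesis
    unfolding theta_term_def using assms by (simp add: power_int_add)
qed

lemma abs_summable_theta_term:
  assumes "w \<noteq> 0" "q \<noteq> 0" "norm q < 1"
  shows "(\<lambda>n. norm (theta_term w q n)) summable_on UNIV"
proof -
  \<comment> \<open>Consecutive terms have ratio at most \<open>C * norm q ^ k\<close>, which tends
    to 0 and so is eventually below 1/2.\<close>
  have ratio: "(\<lambda>k. norm (f k)) summable_on UNIV"
    if f: "\<And>k. norm (f (Suc k)) \<le> C * norm q ^ k * norm (f k)" for f :: "nat \<Rightarrow> complex" and C
  proof -
    have "(\<lambda>k. C * norm q ^ k) \<longlonglongrightarrow> C * 0"
      using assms(3) by (intro tendsto_mult tendsto_const LIMSEQ_power_zero) simp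
    then have "eventually (\<lambda>k. C * norm q ^ k < 1/2) sequentially"
      by (rule order_tendstoD) simp
    then obtain N where N: "\<And>k. k \<ge> N \<Longrightarrow> C * norm q ^ k < 1/2"
      by (auto simp: eventually_sequentially)
    have "summable (\<lambda>k. norm (f k))"
    proof (rule summable_ratio_test[of "1/2" N])
      fix k assume "k \<ge> N"
      from N[OF this] have "C * norm q ^ k * norm (f k) \<le> 1/2 * norm (f k)"
        by (intro mult_right_mono) auto
      with f[of k] show "norm (norm (f (Suc k))) \<le> 1/2 * norm (norm (f k))" by simp
    qed simp
    then show ?thesis
      by (intro summable_nonneg_imp_summable_on) auto
  qed
  have "(\<lambda>k. norm (theta_term w q (int k))) summable_on UNIV"
  proof (rule ratio)
    fix k
    show "norm (theta_term w q (int (Suc k))) \<le> norm w * norm q ^ k * norm (theta_term w q (int k))"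
      using theta_term_Suc[OF assms(1,2), of "int k"] by (simp add: norm_mult norm_power add.commute)
  qed
  then have pos: "(\<lambda>k. norm (theta_term w q k)) summable_on range int"
    by (subst summable_on_reindex) (auto simp: o_def)
  have "(\<lambda>k. norm (theta_term w q (- 1 - int k))) summable_on UNIV"
  proof (rule ratio)
    fix k
    \<comment> \<open>On the negative half the recurrence is read backwards: solving it for the
      lower index gives the ratio \<open>q ^ (k + 2) / w\<close>, which decays again.\<close>
    have eq: "theta_term w q (- 1 - int k) = w * q powi (- 1 - int (Suc k)) * theta_term w q (- 1 - int (Suc k))"
      using theta_term_Suc[OF assms(1,2), of "- 1 - int (Suc k)"] by (simp add: algebra_simps)
    have inv: "q powi (- 1 - int (Suc k)) = inverse (q ^ (k + 2))"
      by (simp add: power_int_def nat_add_distrib power_inverse)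
    have "theta_term w q (- 1 - int (Suc k)) = q ^ (k + 2) / w * theta_term w q (- 1 - int k)"
      unfolding eq inv using assms by (simp add: field_simps)
    then have "norm (theta_term w q (- 1 - int (Suc k)))
        = (norm q)\<^sup>2 / norm w * norm q ^ k * norm (theta_term w q (- 1 - int k))"
      by (simp add: norm_mult norm_divide norm_power power_add field_simps power2_eq_square)
    then show "norm (theta_term w q (- 1 - int (Suc k)))
        \<le> (norm q)\<^sup>2 / norm w * norm q ^ k * norm (theta_term w q (- 1 - int k))" by simp
  qed
  then have neg: "(\<lambda>k. norm (theta_term w q k)) summable_on range (\<lambda>k. - 1 - int k)"
    by (subst summable_on_reindex) (auto simp: o_def inj_on_def)
  have "k \<in> range int \<union> range (\<lambda>k. - 1 - int k)" for k
  proof (cases "k \<ge> 0")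
    case True
    then show ?thesis by (metis UnI1 nonneg_int_cases rangeI)
  next
    case False
    then have "k = - 1 - int (nat (- 1 - k))" by simp
    then show ?thesis by blast
  qed
  then have "UNIV = range int \<union> range (\<lambda>k. - 1 - int k)" by blast
  then show ?thesis
    using summable_on_union[OF pos neg] by simp
qed

lemma has_sum_theta:
  assumes "w \<noteq> 0" "q \<noteq> 0" "norm q < 1"
  shows "(theta_term w q has_sum theta w q) UNIV"
  unfolding theta_def using abs_summable_summable[OF abs_summable_theta_term[OF assms]] by simp

section \<open>The finite form of the triple product and its limit\<close>

definition qfact :: "complex \<Rightarrow> nat \<Rightarrow> complex" where
  "qfact q n = (\<Prod>i<n. 1 - q * q ^ i)"

definition qfact_rec :: "complex \<Rightarrow> int \<Rightarrow> complex" where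
  "qfact_rec q j = (if j < 0 then 0 else 1 / qfact q (nat j))"

lemma one_minus_power_nonzero:
  assumes "norm (q :: complex) < 1" "n > 0"
  shows "1 - q ^ n \<noteq> 0"
proof
  assume "1 - q ^ n = 0"
  then have "norm (q ^ n) = 1" by simp
  with assms show False by (simp add: norm_power power_less_one_iff less_imp_neq)
qed

lemma qfact_nonzero:
  assumes "norm q < 1"
  shows "qfact q n \<noteq> 0"
  unfolding qfact_def using one_minus_power_nonzero[OF assms, of "Suc _"] by simp

lemma qfact_rec_diff_1:
  assumes "norm q < 1"
  shows "qfact_rec q (j - 1) = qfact_rec q j * (1 - q powi j)"
proof (cases "j > 0")
  case True
  then obtain n where n: "j = int (Suc n)" by (metis Suc_pred pos_int_cases)
  have "qfact q (Suc n) = qfact q n * (1 - q ^ Suc n)" by (simp add: qfact_def)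
  then show ?thesis
    using qfact_nonzero[OF assms] one_minus_power_nonzero[OF assms, of "Suc n"]
    by (simp add: qfact_rec_def n power_int_def nat_add_distrib field_simps)
next
  case False
  \<comment> \<open>At \<open>j = 0\<close> the factor \<open>1 - q powi 0\<close> vanishes, in
    agreement with the value 0 of \<open>qfact_rec\<close> at -1.\<close>
  then show ?thesis by (cases "j = 0") (auto simp: qfact_rec_def)
qed

text \<open>Letting the reciprocal of the q-factorial vanish at negative integers makes the recurrence
  for the coefficients uniform in \<open>k\<close>, so no boundary terms occur.\<close>

definition jtp_coeff :: "complex \<Rightarrow> nat \<Rightarrow> int \<Rightarrow> complex" where
  "jtp_coeff q n k = qfact q (2 * n) * qfact_rec q (int n - k) * qfact_rec q (int n + k)"

text \<open>The coefficients are the Gaussian binomials of 2n over n + k, and the recurrence is the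
  one forced by multiplying a finite product by (1 + w q^n)(1 + q^(n+1)/w). Expressing all
  neighbouring reciprocals through \<open>X\<close> and \<open>Y\<close> reduces it to an identity
  in \<open>a\<close>, \<open>b\<close> and \<open>1 / q\<close>.\<close>

lemma jtp_coeff_Suc:
  assumes "q \<noteq> 0" "norm q < 1"
  shows "jtp_coeff q (Suc n) k = (1 + q ^ (2 * n + 1)) * jtp_coeff q n k
      + q powi (int n + 1 - k) * jtp_coeff q n (k - 1) + q powi (int n + 1 + k) * jtp_coeff q n (k + 1)"
proof -
  define a where "a = q powi (int n + 1 - k)"
  define b where "b = q powi (int n + 1 + k)"
  define X where "X = qfact_rec q (int n + 1 - k)"
  define Y where "Y = qfact_rec q (int n + 1 + k)"
  note rec = qfact_rec_diff_1[OF assms(2)]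
  have a': "q powi (int n - k) = a / q"
    using power_int_diff[of q "int n + 1 - k" 1] assms by (simp add: a_def algebra_simps)
  have b': "q powi (int n + k) = b / q"
    using power_int_diff[of q "int n + 1 + k" 1] assms by (simp add: b_def algebra_simps)
  have X1: "qfact_rec q (int n - k) = X * (1 - a)"
    using rec[of "int n + 1 - k"] by (simp add: a_def X_def)
  have Y1: "qfact_rec q (int n + k) = Y * (1 - b)"
    using rec[of "int n + 1 + k"] by (simp add: b_def Y_def)
  have X2: "qfact_rec q (int n - k - 1) = X * (1 - a) * (1 - a / q)"
    using rec[of "int n - k"] by (simp add: X1 a')
  have Y2: "qfact_rec q (int n + k - 1) = Y * (1 - b) * (1 - b / q)"
    using rec[of "int n + k"] by (simp add: Y1 b')
  have "a * b = q powi (int (2 * n + 2))"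
    unfolding a_def b_def using assms by (simp flip: power_int_add add: add.commute)
  then have ab: "a * b = q ^ (2 * n + 2)" by (simp only: power_int_of_nat)
  then have ab': "q ^ (2 * n + 1) = a * b / q"
    using assms by simp
  have f: "qfact q (2 * Suc n) = qfact q (2 * n) * (1 - a * b / q) * (1 - a * b)"
    unfolding ab ab'[symmetric] by (simp add: qfact_def mult.assoc)
  have c0: "jtp_coeff q n k = qfact q (2 * n) * (X * (1 - a)) * (Y * (1 - b))"
    by (simp add: jtp_coeff_def X1 Y1)
  have "int n - (k - 1) = int n + 1 - k" "int n + (k - 1) = int n + k - 1" by simp_all
  then have c1: "jtp_coeff q n (k - 1) = qfact q (2 * n) * X * (Y * (1 - b) * (1 - b / q))"
    unfolding jtp_coeff_def by (simp only: X_def Y2)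
  have "int n - (k + 1) = int n - k - 1" "int n + (k + 1) = int n + 1 + k" by simp_all
  then have c2: "jtp_coeff q n (k + 1) = qfact q (2 * n) * (X * (1 - a) * (1 - a / q)) * Y"
    unfolding jtp_coeff_def by (simp only: Y_def X2)
  have "int (Suc n) - k = int n + 1 - k" "int (Suc n) + k = int n + 1 + k" by simp_all
  then have cS: "jtp_coeff q (Suc n) k = qfact q (2 * n) * (1 - a * b / q) * (1 - a * b) * X * Y"
    unfolding jtp_coeff_def f by (simp only: X_def Y_def)
  \<comment> \<open>Here \<open>t\<close> stands for \<open>1 / q\<close>, so that a purely
    polynomial identity has to be checked.\<close>
  have "(1 - a * b * t) * (1 - a * b)
      = (1 + a * b * t) * (1 - a) * (1 - b) + a * (1 - b) * (1 - b * t) + b * (1 - a) * (1 - a * t)" for t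
    by algebra
  from this[of "1 / q"] have "(1 - a * b / q) * (1 - a * b)
      = (1 + a * b / q) * (1 - a) * (1 - b) + a * (1 - b) * (1 - b / q) + b * (1 - a) * (1 - a / q)"
    by simp
  moreover have "Z * (1 - u) * (1 - a * b) * X * Y
      = (1 + u) * (Z * (X * (1 - a)) * (Y * (1 - b))) + a * (Z * X * (Y * (1 - b) * (1 - v)))
        + b * (Z * (X * (1 - a) * (1 - v')) * Y)"
    if "(1 - u) * (1 - a * b) = (1 + u) * (1 - a) * (1 - b) + a * (1 - b) * (1 - v) + b * (1 - a) * (1 - v')"
    for Z u v v'
    using that by algebra
  ultimately show ?thesis
    unfolding cS c0 c1 c2 ab' a_def[symmetric] b_def[symmetric] by blast
qed

text \<open>Induction on \<open>n\<close>. Only -n \<le> k \<le> n contribute, but summing over all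
  integers makes the shifts to \<open>k - 1\<close> and \<open>k + 1\<close> bijections of the index
  set.\<close>

lemma finite_jacobi_triple_product:
  assumes "w \<noteq> 0" "q \<noteq> 0" "norm q < 1"
  shows "((\<lambda>k. jtp_coeff q n k * theta_term w q k) has_sum
           (\<Prod>i<n. 1 - (- w) * q ^ i) * (\<Prod>i<n. 1 - (- q / w) * q ^ i)) UNIV"
proof (induction n)
  case 0
  have "jtp_coeff q 0 k * theta_term w q k = 0" if "k \<noteq> 0" for k
    using that by (auto simp: jtp_coeff_def qfact_rec_def)
  moreover have "jtp_coeff q 0 0 = 1" by (simp add: jtp_coeff_def qfact_rec_def qfact_def)
  ultimately show ?case
    by (intro has_sum_finite_neutralI[of "{0}"]) auto
next
  case (Suc n)
  define F where "F k = jtp_coeff q n k * theta_term w q k" for k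
  define S where "S = (\<Prod>i<n. 1 - (- w) * q ^ i) * (\<Prod>i<n. 1 - (- q / w) * q ^ i)"
  have F: "(F has_sum S) UNIV" using Suc by (simp add: F_def [abs_def] S_def)
  have F1: "((\<lambda>k. F (k - 1)) has_sum S) UNIV"
    using F by (subst has_sum_reindex_bij_witness[of UNIV "\<lambda>k. k + 1" "\<lambda>k. k - 1" UNIV F _ S S]) auto
  have F2: "((\<lambda>k. F (k + 1)) has_sum S) UNIV"
    using F by (subst has_sum_reindex_bij_witness[of UNIV "\<lambda>k. k - 1" "\<lambda>k. k + 1" UNIV F _ S S]) auto
  have "((\<lambda>k. (1 + q ^ (2 * n + 1)) * F k + w * q ^ n * F (k - 1) + q ^ (n + 1) / w * F (k + 1)) has_sum
      ((1 + q ^ (2 * n + 1)) * S + w * q ^ n * S + q ^ (n + 1) / w * S)) UNIV"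
    by (intro has_sum_add has_sum_cmult_right F F1 F2)
  moreover have "(1 + q ^ (2 * n + 1)) * F k + w * q ^ n * F (k - 1) + q ^ (n + 1) / w * F (k + 1)
      = jtp_coeff q (Suc n) k * theta_term w q k" for k
  proof -
    have t1: "theta_term w q k = w * q powi (k - 1) * theta_term w q (k - 1)"
      using theta_term_Suc[OF assms(1,2), of "k - 1"] by simp
    have t2: "theta_term w q (k + 1) = w * q powi k * theta_term w q k"
      by (rule theta_term_Suc[OF assms(1,2)])
    have "q powi (int n + 1 - k) * q powi (k - 1) = q powi int n"
      using assms by (simp flip: power_int_add)
    then have e1: "q powi (int n + 1 - k) * q powi (k - 1) = q ^ n" by simp
    have "q powi (int n + 1 + k) = q powi int (n + 1) * q powi k"
      using assms by (simp flip: power_int_add add: add_ac)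
    then have e2: "q powi (int n + 1 + k) = q ^ (n + 1) * q powi k" by (simp only: power_int_of_nat)
    have "w * q ^ n * F (k - 1) = q powi (int n + 1 - k) * jtp_coeff q n (k - 1) * theta_term w q k"
      unfolding F_def t1 e1[symmetric] by (simp add: mult_ac)
    moreover have "q ^ (n + 1) / w * F (k + 1) = q powi (int n + 1 + k) * jtp_coeff q n (k + 1) * theta_term w q k"
      unfolding F_def t2 e2 using assms by (simp add: mult_ac)
    ultimately show ?thesis
      unfolding jtp_coeff_Suc[OF assms(2,3)] F_def by (simp add: algebra_simps)
  qed
  moreover have "(1 + q ^ (2 * n + 1)) * S + w * q ^ n * S + q ^ (n + 1) / w * S
      = (\<Prod>i<Suc n. 1 - (- w) * q ^ i) * (\<Prod>i<Suc n. 1 - (- q / w) * q ^ i)"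
  proof -
    have "q ^ (2 * n + 1) = q * q ^ n * q ^ n" by (simp add: mult_2 power_add)
    then have "1 + q ^ (2 * n + 1) + w * q ^ n + q ^ (n + 1) / w
        = (1 - (- w) * q ^ n) * (1 - (- q / w) * q ^ n)"
      using assms by (simp add: field_simps)
    moreover have "(1 + c) * (A * B) + d * (A * B) + e * (A * B) = (A * x) * (B * y)"
      if "1 + c + d + e = x * y" for A B c d e x y :: complex
      using that by algebra
    ultimately show ?thesis unfolding S_def prod.lessThan_Suc by blast
  qed
  ultimately show ?case by simp
qed

lemma qfact_LIMSEQ:
  assumes "norm q < 1"
  shows "qfact q \<longlonglongrightarrow> qpoch_inf q q"
  using qpoch_inf_LIMSEQ[OF assms, of q] by (simp add: qfact_def [abs_def])

text \<open>This is the limit of the finite form: each coefficient tends to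
  \<open>1 / qpoch_inf q q\<close>, and all of them obey one common bound, so Tannery's theorem
  allows the limit to be taken term by term.\<close>

theorem jacobi_triple_product:
  assumes "w \<noteq> 0" "q \<noteq> 0" "norm q < 1"
  shows "theta w q = qpoch_inf (- w) q * qpoch_inf (- q / w) q * qpoch_inf q q"
proof -
  let ?E = "qpoch_inf q q"
  have E: "?E \<noteq> 0" by (rule qpoch_inf_nonzero) (use assms in auto)
  have lim: "qfact q \<longlonglongrightarrow> ?E" by (rule qfact_LIMSEQ[OF assms(3)])
  have rlim: "(\<lambda>n. 1 / qfact q n) \<longlonglongrightarrow> 1 / ?E"
    by (intro tendsto_divide tendsto_const lim E)
  obtain K1 where K1: "\<And>n. norm (qfact q n) \<le> K1"
    using convergent_imp_Bseq[OF convergentI[OF lim]] by (auto simp: Bseq_def)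
  obtain K2 where K2: "K2 > 0" "\<And>n. norm (1 / qfact q n) \<le> K2"
    using convergent_imp_Bseq[OF convergentI[OF rlim]] by (auto simp: Bseq_def)
  have K2': "norm (qfact_rec q j) \<le> K2" for j
    using K2 by (auto simp: qfact_rec_def)
  have bound: "norm (jtp_coeff q n k) \<le> K1 * K2 * K2" for n k
    unfolding jtp_coeff_def norm_mult
    by (intro mult_mono K1 K2' mult_nonneg_nonneg order_trans[OF norm_ge_zero K1]) (use K2 in auto)
  \<comment> \<open>For large \<open>n\<close> the argument is nonnegative, so the value 0 at
    negative integers does not affect the limit.\<close>
  have rec_lim: "(\<lambda>n. qfact_rec q (int n + k)) \<longlonglongrightarrow> 1 / ?E" for k
  proof -
    have "filterlim (\<lambda>n. nat (int n + k)) at_top sequentially"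
      unfolding filterlim_at_top
    proof
      fix Z
      show "eventually (\<lambda>n. Z \<le> nat (int n + k)) sequentially"
        using eventually_ge_at_top[of "Z + nat \<bar>k\<bar>"] by eventually_elim linarith
    qed
    from filterlim_compose[OF rlim this]
    have "(\<lambda>n. 1 / qfact q (nat (int n + k))) \<longlonglongrightarrow> 1 / ?E" .
    moreover have "eventually (\<lambda>n. 1 / qfact q (nat (int n + k)) = qfact_rec q (int n + k)) sequentially"
      using eventually_ge_at_top[of "nat \<bar>k\<bar>"]
      by eventually_elim (simp add: qfact_rec_def)
    ultimately show ?thesis by (rule Lim_transform_eventually)
  qed
  have "filterlim (\<lambda>n::nat. 2 * n) at_top sequentially"
    by (intro filterlim_subseq) (simp add: strict_mono_def)
  from filterlim_compose[OF lim this]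
  have lim2: "(\<lambda>n. qfact q (2 * n)) \<longlonglongrightarrow> ?E" .
  have coeff_lim: "(\<lambda>n. jtp_coeff q n k) \<longlonglongrightarrow> ?E * (1 / ?E) * (1 / ?E)" for k
    unfolding jtp_coeff_def
    using rec_lim[of "- k"] by (intro tendsto_mult lim2 rec_lim) simp
  define W where "W n = (\<Prod>i<n. 1 - (- w) * q ^ i) * (\<Prod>i<n. 1 - (- q / w) * q ^ i)" for n
  \<comment> \<open>The enumeration \<open>int_decode\<close> of the integers turns the unordered
    sums into ordinary series, as Tannery's theorem requires.\<close>
  have decode: "(\<lambda>j. f (int_decode j)) sums s" if "(f has_sum s) UNIV" for f and s :: complex
    using that has_sum_reindex_bij_betw[OF bij_int_decode] has_sum_imp_sums by metis
  have W: "(\<Sum>j. jtp_coeff q n (int_decode j) * theta_term w q (int_decode j)) = W n" for n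
    using decode[OF finite_jacobi_triple_product[OF assms]] by (simp add: sums_iff W_def)
  have T: "(\<Sum>j. theta_term w q (int_decode j)) = theta w q"
    and Ts: "summable (\<lambda>j. theta_term w q (int_decode j))"
    using decode[OF has_sum_theta[OF assms]] by (simp_all add: sums_iff)
  have "(\<lambda>j. norm (theta_term w q (int_decode j))) summable_on UNIV"
    using abs_summable_theta_term[OF assms] summable_on_reindex_bij_betw[OF bij_int_decode, of "\<lambda>j. norm (theta_term w q j)"]
    by simp
  then have sm: "summable (\<lambda>j. K1 * K2 * K2 * norm (theta_term w q (int_decode j)))"
    by (intro summable_mult summable_on_imp_summable)
  have "((\<lambda>n. \<Sum>j. jtp_coeff q n (int_decode j) * theta_term w q (int_decode j)) \<longlongrightarrow>
          (\<Sum>j. 1 / ?E * theta_term w q (int_decode j))) sequentially"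
  proof (rule conjunct2[OF conjunct2[OF tannerys_theorem[OF _ _ sm]]])
    fix j
    show "(\<lambda>n. jtp_coeff q n (int_decode j) * theta_term w q (int_decode j))
        \<longlonglongrightarrow> 1 / ?E * theta_term w q (int_decode j)"
      using coeff_lim[of "int_decode j"] E by (intro tendsto_mult tendsto_const) simp
  next
    show "\<forall>\<^sub>F (j, n) in sequentially \<times>\<^sub>F sequentially.
        norm (jtp_coeff q n (int_decode j) * theta_term w q (int_decode j))
        \<le> K1 * K2 * K2 * norm (theta_term w q (int_decode j))"
      by (intro always_eventually) (auto simp: norm_mult intro!: mult_right_mono bound)
  qed simp
  then have "W \<longlonglongrightarrow> 1 / ?E * theta w q"
    unfolding W suminf_mult[OF Ts] T .
  moreover have "W \<longlonglongrightarrow> qpoch_inf (- w) q * qpoch_inf (- q / w) q"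
    unfolding W_def by (intro tendsto_mult qpoch_inf_LIMSEQ assms)
  ultimately have "1 / ?E * theta w q = qpoch_inf (- w) q * qpoch_inf (- q / w) q"
    using LIMSEQ_unique by blast
  then show ?thesis using E by (simp add: field_simps)
qed

section \<open>Double theta series\<close>

lemma has_sum_times:
  fixes f g :: "_ \<Rightarrow> complex"
  assumes "(f has_sum a) A" "(g has_sum b) B"
    and "(\<lambda>x. norm (f x)) summable_on A" "(\<lambda>y. norm (g y)) summable_on B"
  shows "((\<lambda>(x, y). f x * g y) has_sum a * b) (A \<times> B)"
proof (rule has_sum_SigmaI)
  show "((\<lambda>y. case (x, y) of (x, y) \<Rightarrow> f x * g y) has_sum f x * b) B" for x
    using assms(2) by (simp add: has_sum_cmult_right)
  show "((\<lambda>x. f x * b) has_sum a * b) A"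
    using assms(1) by (rule has_sum_cmult_left)
  have "(\<lambda>p. norm (case p of (x, y) \<Rightarrow> f x * g y)) summable_on A \<times> B"
  proof (rule summable_on_SigmaI)
    show "((\<lambda>y. norm (case (x, y) of (x, y) \<Rightarrow> f x * g y)) has_sum norm (f x) * infsum (\<lambda>y. norm (g y)) B) B" for x
      using has_sum_infsum[OF assms(4)] by (simp add: norm_mult has_sum_cmult_right)
    show "(\<lambda>x. norm (f x) * infsum (\<lambda>y. norm (g y)) B) summable_on A"
      using assms(3) by (rule summable_on_cmult_left)
  qed auto
  then show "(\<lambda>(x, y). f x * g y) summable_on A \<times> B"
    by (rule abs_summable_summable)
qed

text \<open>The bijections provide a separate change of variable in each factor; with them a sum
  over a lattice coset is recognised as a product of two theta series.\<close>

lemma has_sum_theta_times: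
  assumes "w \<noteq> 0" "q \<noteq> 0" "norm q < 1" "w' \<noteq> 0" "q' \<noteq> 0" "norm q' < 1" "bij \<sigma>" "bij \<tau>"
  shows "((\<lambda>(n, m). theta_term w q (\<sigma> n) * theta_term w' q' (\<tau> m)) has_sum theta w q * theta w' q') UNIV"
proof -
  let ?f = "\<lambda>(n, m). theta_term w q n * theta_term w' q' m"
  have "(?f has_sum theta w q * theta w' q') (UNIV \<times> UNIV)"
    by (intro has_sum_times has_sum_theta abs_summable_theta_term assms)
  moreover have "bij_betw (map_prod \<sigma> \<tau>) (UNIV \<times> UNIV) (UNIV \<times> UNIV)"
    using assms by (intro bij_betw_map_prod)
  ultimately have "((\<lambda>p. ?f (map_prod \<sigma> \<tau> p)) has_sum theta w q * theta w' q') UNIV"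
    using has_sum_reindex_bij_betw[of "map_prod \<sigma> \<tau>" UNIV UNIV ?f] by simp
  then show ?thesis by (simp add: case_prod_unfold)
qed

lemma bij_int_translate: "bij (\<lambda>n::int. n + a)"
  by (rule bij_betw_byWitness[where f' = "\<lambda>n. n - a"]) auto

lemma bij_int_reflect: "bij (\<lambda>n::int. a - n)"
  by (rule bij_betw_byWitness[where f' = "\<lambda>n. a - n"]) auto

text \<open>Regrouping of an unordered sum along five cosets, where \<open>G c\<close> parametrises
  the coset with label \<open>c\<close>.\<close>

lemma has_sum_partition_mod_5:
  fixes F :: "int \<times> int \<Rightarrow> complex" and G :: "int \<Rightarrow> int \<times> int \<Rightarrow> int \<times> int"
  assumes F: "(F has_sum S) UNIV"
    and G: "bij_betw (\<lambda>(c, p). G c p) ({0..<5} \<times> UNIV) UNIV"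
    and s: "\<And>c. c \<in> {0..<5} \<Longrightarrow> ((\<lambda>p. F (G c p)) has_sum s c) UNIV"
  shows "S = s 0 + s 1 + s 2 + s 3 + s 4"
proof -
  have "((\<lambda>(c, p). F (G c p)) has_sum S) ({0..<5} \<times> UNIV)"
    using F has_sum_reindex_bij_betw[OF G, of F S] by (simp add: case_prod_unfold)
  then have "(s has_sum S) {0..<5}"
    by (rule has_sum_SigmaD) (use s in auto)
  moreover have "(s has_sum sum s {0..<5}) {0..<5}" by simp
  ultimately have "S = sum s {0..<5}" by (rule has_sum_unique)
  moreover have "{0..<5} = {0, 1, 2, 3, 4::int}" by auto
  ultimately show ?thesis by simp
qed

lemma two_times_triangular: "2 * (n * (n - 1) div 2) = n * n - (n::int)"
proof -
  have "even (n * (n - 1))" by simp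
  then have "2 * (n * (n - 1) div 2) = n * (n - 1)" by simp
  then show ?thesis by (simp add: algebra_simps)
qed

text \<open>The exponent is doubled in the hypothesis to remove the division by 2, so that
  applications need only polynomial identities.\<close>

lemma theta_term_power:
  assumes "q \<noteq> 0" "2 * e = 2 * int a * n + int b * (n * n - n)"
  shows "theta_term (q ^ a) (q ^ b) n = q powi e"
proof -
  have "2 * (int a * n + int b * (n * (n - 1) div 2)) = 2 * int a * n + int b * (2 * (n * (n - 1) div 2))"
    by (simp only: algebra_simps)
  also have "\<dots> = 2 * e" unfolding two_times_triangular by (rule assms(2)[symmetric])
  finally have "e = int a * n + int b * (n * (n - 1) div 2)" by simp
  then show ?thesis
    using assms(1) by (simp add: theta_term_def power_int_power power_int_add)
qed

lemma theta_term_uminus_power: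
  assumes "q \<noteq> 0" "2 * e = 2 * int a * n + int b * (n * n - n)"
  shows "theta_term (- (q ^ a)) (q ^ b) n = (- 1) powi n * q powi e"
proof -
  have "theta_term (- (q ^ a)) (q ^ b) n = (- 1) powi n * theta_term (q ^ a) (q ^ b) n"
    using power_int_mult_distrib[of "- 1" "q ^ a" n] by (simp add: theta_term_def)
  then show ?thesis using theta_term_power[OF assms] by simp
qed

lemma minus_one_power_int_cong:
  assumes "even (k - l)"
  shows "(- 1 :: complex) powi k = (- 1) powi l"
proof -
  have "(- 1 :: complex) powi (k - l) = 1" using assms by (simp add: power_int_minus_left)
  then show ?thesis by (simp add: power_int_diff)
qed

section \<open>Two theta identities from cosets of index 5\<close>

text \<open>The first square is the sum of q^(x^2+y^2) over the integer lattice. The vectors (2, 1)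
  and (1, -2) are orthogonal, have squared length 5 and span the sublattice x = 2y mod 5. That
  sublattice yields the second square, and each of the other four cosets yields the same product
  \<open>q * (U * V)\<close>.\<close>

lemma theta_square_diff:
  assumes "q \<noteq> 0" "norm q < 1"
  shows "(theta q (q\<^sup>2))\<^sup>2 - (theta (q ^ 5) (q ^ 10))\<^sup>2 = 4 * q * (theta q (q ^ 10) * theta (q ^ 3) (q ^ 10))"
proof -
  note pow = norm_power_less_1[OF assms(2)]
  define F where "F = (\<lambda>(x, y). theta_term q (q\<^sup>2) x * theta_term q (q\<^sup>2) y)"
  define G :: "int \<Rightarrow> int \<times> int \<Rightarrow> int \<times> int"
    where "G c = (\<lambda>(n, m). (2 * n + m + c, n - 2 * m))" for c
  define U where "U = theta q (q ^ 10)"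
  define V where "V = theta (q ^ 3) (q ^ 10)"
  define s where "s c = (if c = 0 then (theta (q ^ 5) (q ^ 10))\<^sup>2 else q * (U * V))" for c :: int
  have F: "(F has_sum (theta q (q\<^sup>2))\<^sup>2) UNIV"
    unfolding power2_eq_square[of "theta q (q\<^sup>2)"] F_def
    using assms pow[of 2] by (intro has_sum_theta_times bij_id[unfolded id_def]) auto
  \<comment> \<open>The inverse comes from \<open>x - 2 * y = 5 * m + c\<close> and
    \<open>n = y + 2 * m\<close>.\<close>
  have G: "bij_betw (\<lambda>(c, p). G c p) ({0..<5} \<times> UNIV) UNIV"
    by (rule bij_betw_byWitness[where f' = "\<lambda>(x, y). ((x - 2 * y) mod 5, (y + 2 * ((x - 2 * y) div 5), (x - 2 * y) div 5))"])
      (auto simp: G_def; presburger)+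
  have FG: "F (G c (n, m)) = q powi (5 * n * n + 5 * m * m + 4 * n * c + 2 * m * c + c * c)" for c n m
  proof -
    have "theta_term q (q\<^sup>2) x = q powi (x * x)" for x
      using theta_term_power[of q "x * x" 1 x 2] assms by simp
    then have "F (G c (n, m)) = q powi ((2 * n + m + c) * (2 * n + m + c) + (n - 2 * m) * (n - 2 * m))"
      using assms by (simp add: F_def G_def power_int_add)
    also have "(2 * n + m + c) * (2 * n + m + c) + (n - 2 * m) * (n - 2 * m)
        = 5 * n * n + 5 * m * m + 4 * n * c + 2 * m * c + c * c"
      by (simp add: algebra_simps)
    finally show ?thesis .
  qed
  have u: "theta_term q (q ^ 10) n = q powi (5 * n * n - 4 * n)" for n
    using theta_term_power[of q "5 * n * n - 4 * n" 1 n 10] assms by simp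
  have v: "theta_term (q ^ 3) (q ^ 10) n = q powi (5 * n * n - 2 * n)" for n
    using theta_term_power[of q "5 * n * n - 2 * n" 3 n 10] assms by simp
  have p5: "theta_term (q ^ 5) (q ^ 10) n = q powi (5 * n * n)" for n
    using theta_term_power[of q "5 * n * n" 5 n 10] assms by simp
  have pq: "q * (q powi k * q powi l) = q powi (k + l + 1)" for k l
    using assms by (simp add: power_int_add)
  \<comment> \<open>In the classes 1 and 4 the variable \<open>n\<close> carries the series
    \<open>U\<close>, in the classes 2 and 3 it carries \<open>V\<close>; \<open>\<sigma>\<close>
    and \<open>\<tau>\<close> absorb the translations and reflections needed to match the
    exponents.\<close>
  have UV: "((\<lambda>p. F (G c p)) has_sum s c) UNIV"
    if "bij \<sigma>" "bij \<tau>" "c \<noteq> 0"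
      "\<And>n m. 5 * n * n + 5 * m * m + 4 * n * c + 2 * m * c + c * c
        = (5 * \<sigma> n * \<sigma> n - 4 * \<sigma> n) + (5 * \<tau> m * \<tau> m - 2 * \<tau> m) + 1" for \<sigma> \<tau> c
  proof -
    have "((\<lambda>p. q * (case p of (n, m) \<Rightarrow> theta_term q (q ^ 10) (\<sigma> n) * theta_term (q ^ 3) (q ^ 10) (\<tau> m)))
        has_sum q * (U * V)) UNIV"
      unfolding U_def V_def
      using that assms pow[of 10] by (intro has_sum_cmult_right has_sum_theta_times) auto
    moreover have "q * (theta_term q (q ^ 10) (\<sigma> n) * theta_term (q ^ 3) (q ^ 10) (\<tau> m)) = F (G c (n, m))" for n m
      unfolding FG u v pq that(4) ..
    ultimately show ?thesis using that(3) by (simp add: s_def case_prod_unfold)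
  qed
  have VU: "((\<lambda>p. F (G c p)) has_sum s c) UNIV"
    if "bij \<sigma>" "bij \<tau>" "c \<noteq> 0"
      "\<And>n m. 5 * n * n + 5 * m * m + 4 * n * c + 2 * m * c + c * c
        = (5 * \<sigma> n * \<sigma> n - 2 * \<sigma> n) + (5 * \<tau> m * \<tau> m - 4 * \<tau> m) + 1" for \<sigma> \<tau> c
  proof -
    have "((\<lambda>p. q * (case p of (n, m) \<Rightarrow> theta_term (q ^ 3) (q ^ 10) (\<sigma> n) * theta_term q (q ^ 10) (\<tau> m)))
        has_sum q * (V * U)) UNIV"
      unfolding U_def V_def
      using that assms pow[of 10] by (intro has_sum_cmult_right has_sum_theta_times) auto
    moreover have "q * (theta_term (q ^ 3) (q ^ 10) (\<sigma> n) * theta_term q (q ^ 10) (\<tau> m)) = F (G c (n, m))" for n m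
      unfolding FG u v pq that(4) ..
    ultimately show ?thesis using that(3) by (simp add: s_def case_prod_unfold mult.commute[of V])
  qed
  have "((\<lambda>p. F (G c p)) has_sum s c) UNIV" if c: "c \<in> {0..<5}" for c
  proof -
    consider "c = 0" | "c = 1" | "c = 2" | "c = 3" | "c = 4" using c by fastforce
    then show ?thesis
    proof cases
      case 1
      have "((\<lambda>(n, m). theta_term (q ^ 5) (q ^ 10) n * theta_term (q ^ 5) (q ^ 10) m) has_sum
          theta (q ^ 5) (q ^ 10) * theta (q ^ 5) (q ^ 10)) UNIV"
        using assms pow[of 10] by (intro has_sum_theta_times bij_id[unfolded id_def]) auto
      moreover have "theta_term (q ^ 5) (q ^ 10) n * theta_term (q ^ 5) (q ^ 10) m = F (G 0 (n, m))" for n m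
        unfolding FG p5 using assms by (simp add: power_int_add)
      ultimately show ?thesis using 1 by (simp add: s_def case_prod_unfold power2_eq_square)
    next
      case 2
      show ?thesis unfolding 2
        by (rule UV[OF bij_int_reflect[of 0] bij_int_reflect[of 0]]) (simp_all add: algebra_simps)
    next
      case 3
      show ?thesis unfolding 3
        by (rule VU[OF bij_int_translate[of 1] bij_int_reflect[of 0]]) (simp_all add: algebra_simps)
    next
      case 4
      show ?thesis unfolding 4
        by (rule VU[OF bij_int_reflect[of "-1"] bij_int_translate[of 1]]) (simp_all add: algebra_simps)
    next
      case 5
      show ?thesis unfolding 5
        by (rule UV[OF bij_int_translate[of 2] bij_int_translate[of 1]]) (simp_all add: algebra_simps)
    qed
  qed
  from has_sum_partition_mod_5[OF F G this]
  show ?thesis by (simp add: s_def U_def V_def)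
qed

text \<open>For \<open>w = - q\<close> the triple product contains \<open>qpoch_inf 1 q\<close>,
  whose factor of index 0 is 0.\<close>

lemma theta_eq_0:
  assumes "q \<noteq> 0" "norm q < 1"
  shows "theta (- q) q = 0"
proof -
  have "qpoch_inf 1 q = 0"
    using has_prod_zeroI[OF qpoch_inf_has_prod[OF assms(2), of 1], of 0] by simp
  then show ?thesis
    using jacobi_triple_product[of "- q" q] assms by simp
qed

text \<open>The residue class \<open>c = 2\<close> contributes a theta series that vanishes identically.\<close>

lemma theta_product_sum:
  assumes "q \<noteq> 0" "norm q < 1"
  shows "theta q q * theta (- (q ^ 2)) (q ^ 4)
    = 2 * (theta (- (q ^ 3)) (q ^ 5) * theta (- (q ^ 12)) (q ^ 20)
      + q * (theta (- (q ^ 4)) (q ^ 5) * theta (- (q ^ 16)) (q ^ 20)))"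
proof -
  note pow = norm_power_less_1[OF assms(2)]
  define F where "F = (\<lambda>(x, y). theta_term q q x * theta_term (- (q ^ 2)) (q ^ 4) y)"
  \<comment> \<open>The directions (1, -1) and (4, 1) are orthogonal for the quadratic part x^2/2 +
    2y^2 of the exponent, so no mixed term \<open>m * n\<close> arises. They span the sublattice x +
    y = 0 mod 5.\<close>
  define G :: "int \<Rightarrow> int \<times> int \<Rightarrow> int \<times> int"
    where "G c = (\<lambda>(n, m). (4 * m + n + c, m - n))" for c
  define T where "T k a b = q ^ k * (theta (- (q ^ a)) (q ^ 5) * theta (- (q ^ b)) (q ^ 20))" for k a b :: nat
  define s where "s c = (if c = 0 \<or> c = 4 then T 0 3 12 else if c = 2 then T 3 5 20 else T 1 4 16)" for c :: int
  have F: "(F has_sum theta q q * theta (- (q ^ 2)) (q ^ 4)) UNIV"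
    unfolding F_def
    using assms pow[of 4] by (intro has_sum_theta_times bij_id[unfolded id_def]) auto
  \<comment> \<open>The two coordinates add up to \<open>5 * m + c\<close>, and the second one is
    \<open>m - n\<close>; this determines \<open>c\<close>, \<open>m\<close> and
    \<open>n\<close>.\<close>
  have G: "bij_betw (\<lambda>(c, p). G c p) ({0..<5} \<times> UNIV) UNIV"
    by (rule bij_betw_byWitness[where f' = "\<lambda>(n, m). ((n + m) mod 5, ((n + m) div 5 - m, (n + m) div 5))"])
      (auto simp: G_def; presburger)+
  \<comment> \<open>The exponent is x(x+1)/2 + 2y^2, given here in doubled form.\<close>
  have FG: "F (G c (n, m)) = (- 1) powi (m - n) * q powi e"
    if "2 * e = 20 * m * m + 5 * n * n + (2 * c + 1) * (4 * m + n) + c * (c + 1)" for c n m e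
  proof -
    let ?x = "4 * m + n + c" and ?y = "m - n"
    have "theta_term q q ?x = q powi (e - 2 * ?y * ?y)"
      by (rule theta_term_power[of q _ 1 _ 1, simplified power_one_right])
        (use assms that in \<open>simp_all add: algebra_simps\<close>)
    moreover have "theta_term (- (q ^ 2)) (q ^ 4) ?y = (- 1) powi ?y * q powi (2 * ?y * ?y)"
      by (rule theta_term_uminus_power) (use assms in \<open>simp_all add: algebra_simps\<close>)
    moreover have "q powi e = q powi (e - 2 * ?y * ?y) * q powi (2 * ?y * ?y)"
      using assms by (simp flip: power_int_add)
    ultimately show ?thesis by (simp add: F_def G_def mult_ac)
  qed
  \<comment> \<open>The parity condition transports the sign, the polynomial condition the doubled
    exponent. Classes 0 and 4 give the same product, as do 1 and 3: the second of each pair uses the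
    reflection \<open>-1 - n\<close> in both variables.\<close>
  have residue_class: "((\<lambda>p. F (G c p)) has_sum T k a b) UNIV"
    if "bij \<sigma>" "bij \<tau>" "\<And>n m. even (\<sigma> n + \<tau> m - (m - n))"
      "\<And>n m. 20 * m * m + 5 * n * n + (2 * c + 1) * (4 * m + n) + c * (c + 1)
        = 2 * int k + (2 * int a * \<sigma> n + 5 * (\<sigma> n * \<sigma> n - \<sigma> n)) + (2 * int b * \<tau> m + 20 * (\<tau> m * \<tau> m - \<tau> m))"
    for \<sigma> \<tau> c k a b
  proof -
    have "((\<lambda>p. q ^ k * (case p of (n, m) \<Rightarrow> theta_term (- (q ^ a)) (q ^ 5) (\<sigma> n) * theta_term (- (q ^ b)) (q ^ 20) (\<tau> m)))
        has_sum T k a b) UNIV"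
      unfolding T_def
      using that assms pow[of 5] pow[of 20] by (intro has_sum_cmult_right has_sum_theta_times) auto
    moreover have "q ^ k * (theta_term (- (q ^ a)) (q ^ 5) (\<sigma> n) * theta_term (- (q ^ b)) (q ^ 20) (\<tau> m)) = F (G c (n, m))" for n m
    proof -
      define x where "x = int a * \<sigma> n + 5 * (\<sigma> n * (\<sigma> n - 1) div 2)"
      define y where "y = int b * \<tau> m + 20 * (\<tau> m * (\<tau> m - 1) div 2)"
      have double: "2 * (i * u + j * t) = 2 * i * u + j * (u * u - u)" if "2 * t = u * u - u" for i j u t :: int
        using that by algebra
      have x: "2 * x = 2 * int a * \<sigma> n + 5 * (\<sigma> n * \<sigma> n - \<sigma> n)"
        unfolding x_def using two_times_triangular[of "\<sigma> n"] by (rule double)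
      have y: "2 * y = 2 * int b * \<tau> m + 20 * (\<tau> m * \<tau> m - \<tau> m)"
        unfolding y_def using two_times_triangular[of "\<tau> m"] by (rule double)
      have "F (G c (n, m)) = (- 1) powi (m - n) * q powi (int k + x + y)"
        by (rule FG) (use that(4)[of m n] x y in simp)
      also have "(- 1 :: complex) powi (m - n) = (- 1) powi (\<sigma> n + \<tau> m)"
        by (rule minus_one_power_int_cong[symmetric]) (rule that(3))
      finally show ?thesis
        using theta_term_uminus_power[of q x a "\<sigma> n" 5] theta_term_uminus_power[of q y b "\<tau> m" 20] x y assms
        by (simp add: power_int_add mult_ac)
    qed
    ultimately show ?thesis by (simp add: case_prod_unfold)
  qed
  have "((\<lambda>p. F (G c p)) has_sum s c) UNIV" if c: "c \<in> {0..<5}" for c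
  proof -
    consider "c = 0" | "c = 1" | "c = 2" | "c = 3" | "c = 4" using c by fastforce
    then show ?thesis
    proof cases
      case 1
      have "((\<lambda>p. F (G 0 p)) has_sum T 0 3 12) UNIV"
        by (rule residue_class[OF bij_int_translate[of 0] bij_int_translate[of 0]]) (simp_all add: algebra_simps)
      then show ?thesis using 1 by (simp add: s_def)
    next
      case 2
      have "((\<lambda>p. F (G 1 p)) has_sum T 1 4 16) UNIV"
        by (rule residue_class[OF bij_int_translate[of 0] bij_int_translate[of 0]]) (simp_all add: algebra_simps)
      then show ?thesis using 2 by (simp add: s_def)
    next
      case 3
      have "((\<lambda>p. F (G 2 p)) has_sum T 3 5 20) UNIV"
        by (rule residue_class[OF bij_int_translate[of 0] bij_int_translate[of 0]]) (simp_all add: algebra_simps)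
      then show ?thesis using 3 by (simp add: s_def)
    next
      case 4
      have "((\<lambda>p. F (G 3 p)) has_sum T 1 4 16) UNIV"
        by (rule residue_class[OF bij_int_reflect[of "-1"] bij_int_reflect[of "-1"]]) (simp_all add: algebra_simps)
      then show ?thesis using 4 by (simp add: s_def)
    next
      case 5
      have "((\<lambda>p. F (G 4 p)) has_sum T 0 3 12) UNIV"
        by (rule residue_class[OF bij_int_reflect[of "-1"] bij_int_reflect[of "-1"]]) (simp_all add: algebra_simps)
      then show ?thesis using 5 by (simp add: s_def)
    qed
  qed
  from has_sum_partition_mod_5[OF F G this]
  have "theta q q * theta (- (q ^ 2)) (q ^ 4) = 2 * T 0 3 12 + 2 * T 1 4 16 + T 3 5 20"
    by (simp add: s_def)
  moreover have "T 3 5 20 = 0"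
    using theta_eq_0[of "q ^ 5"] assms pow[of 5] by (simp add: T_def)
  ultimately show ?thesis by (simp add: T_def)
qed

section \<open>Evaluation of the products\<close>

lemma qpoch_inf_split_2:
  assumes "norm q < 1"
  shows "qpoch_inf a q = qpoch_inf a (q ^ 2) * qpoch_inf (a * q) (q ^ 2)"
proof -
  have "{..<2} = {0, 1::nat}" by auto
  then show ?thesis using qpoch_inf_split[OF assms, of 2 a] by simp
qed

lemma qpoch_inf_split_5:
  assumes "norm q < 1"
  shows "qpoch_inf a q = qpoch_inf a (q ^ 5) * qpoch_inf (a * q) (q ^ 5) * qpoch_inf (a * q ^ 2) (q ^ 5)
    * qpoch_inf (a * q ^ 3) (q ^ 5) * qpoch_inf (a * q ^ 4) (q ^ 5)"
proof -
  have "{..<5} = {0, 1, 2, 3, 4::nat}" by auto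
  then show ?thesis using qpoch_inf_split[OF assms, of 5 a] by (simp add: mult.assoc)
qed

abbreviation euler_prod :: "nat \<Rightarrow> complex \<Rightarrow> complex" where
  "euler_prod k q \<equiv> qpoch_inf (q ^ k) (q ^ k)"

text \<open>The reciprocals of the Rogers--Ramanujan functions \<open>G\<close> and \<open>H\<close> in their product form.\<close>

definition rr_G_rec :: "complex \<Rightarrow> complex" where
  "rr_G_rec q = qpoch_inf q (q ^ 5) * qpoch_inf (q ^ 4) (q ^ 5)"

definition rr_H_rec :: "complex \<Rightarrow> complex" where
  "rr_H_rec q = qpoch_inf (q ^ 2) (q ^ 5) * qpoch_inf (q ^ 3) (q ^ 5)"

lemma rr_rec_nonzero:
  assumes "norm q < 1"
  shows "rr_G_rec q \<noteq> 0" "rr_H_rec q \<noteq> 0"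
  unfolding rr_G_rec_def rr_H_rec_def
  by (intro no_zero_divisors qpoch_inf_nonzero norm_power_less_1 assms; simp)+

text \<open>Exponents congruent to 1, 4 mod 5 make up \<open>rr_G_rec\<close>, those congruent to 2,
  3 make up \<open>rr_H_rec\<close>, and the multiples of 5 form
  \<open>euler_prod 5 q\<close>.\<close>

lemma rr_rec_product:
  assumes "norm q < 1"
  shows "rr_G_rec q * rr_H_rec q * euler_prod 5 q = euler_prod 1 q"
proof -
  have "q * q = q ^ 2" "q * q ^ 2 = q ^ 3" "q * q ^ 3 = q ^ 4" "q * q ^ 4 = q ^ 5"
    by (simp_all add: numeral_eq_Suc)
  then show ?thesis
    using qpoch_inf_split_5[OF assms, of q] by (simp add: rr_G_rec_def rr_H_rec_def)
qed

lemma euler_prod_nonzero: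
  assumes "norm q < 1" "k > 0"
  shows "euler_prod k q \<noteq> 0"
  using norm_power_less_1[OF assms] by (simp add: qpoch_inf_nonzero)

lemma euler_prod_double:
  assumes "norm q < 1"
  shows "euler_prod 1 q = qpoch_inf q (q ^ 2) * euler_prod 2 q"
  using qpoch_inf_split_2[OF assms, of q] by (simp add: power2_eq_square)

text \<open>Multiplying \<open>qpoch_inf (- q) (q ^ 2)\<close> by \<open>qpoch_inf q (q ^ 2)\<close>
  gives \<open>qpoch_inf (q ^ 2) (q ^ 4)\<close>; both of these are quotients of consecutive Euler
  products.\<close>

lemma qpoch_inf_odd_product:
  assumes "norm q < 1"
  shows "qpoch_inf (- q) (q ^ 2) * euler_prod 1 q * euler_prod 4 q = (euler_prod 2 q)\<^sup>2"
proof -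
  have 2: "norm (q ^ 2) < 1" using assms by (rule norm_power_less_1) simp
  have "qpoch_inf q (q ^ 2) * qpoch_inf (- q) (q ^ 2) = qpoch_inf (q ^ 2) (q ^ 4)"
    using qpoch_inf_mult_uminus[OF 2, of q] by simp
  moreover have "euler_prod 2 q = qpoch_inf (q ^ 2) (q ^ 4) * euler_prod 4 q"
    using euler_prod_double[OF 2] by simp
  ultimately show ?thesis
    using euler_prod_double[OF assms] by (simp add: power2_eq_square mult_ac)
qed

text \<open>Euler's theorem on partitions into distinct and into odd parts, obtained by cancelling
  \<open>euler_prod 2 q\<close>.\<close>

lemma euler_distinct_odd:
  assumes "norm q < 1"
  shows "qpoch_inf (- q) q * qpoch_inf q (q ^ 2) = 1"
proof -
  have "qpoch_inf q q * qpoch_inf (- q) q = euler_prod 2 q"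
    using qpoch_inf_mult_uminus[OF assms, of q] by simp
  with euler_prod_double[OF assms]
  have "euler_prod 2 q * (qpoch_inf (- q) q * qpoch_inf q (q ^ 2)) = euler_prod 2 q"
    by (simp add: mult_ac)
  then show ?thesis using euler_prod_nonzero[OF assms, of 2] by simp
qed

lemma qpoch_inf_minus_one:
  assumes "norm q < 1"
  shows "qpoch_inf (- 1) q = 2 * qpoch_inf (- q) q"
proof -
  have "(\<lambda>n. \<Prod>i<Suc n. 1 - (- 1) * q ^ i) \<longlonglongrightarrow> qpoch_inf (- 1) q"
    by (rule LIMSEQ_Suc[OF qpoch_inf_LIMSEQ[OF assms]])
  moreover have "(\<Prod>i<Suc n. 1 - (- 1) * q ^ i) = 2 * (\<Prod>i<n. 1 - (- q) * q ^ i)" for n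
    unfolding prod.lessThan_Suc_shift by simp
  moreover have "(\<lambda>n. 2 * (\<Prod>i<n. 1 - (- q) * q ^ i)) \<longlonglongrightarrow> 2 * qpoch_inf (- q) q"
    by (intro tendsto_mult tendsto_const qpoch_inf_LIMSEQ assms)
  ultimately show ?thesis by (simp only:) (rule LIMSEQ_unique)
qed

text \<open>The product form of Ramanujan's \<phi>(q). From it continuity and the absence of zeros
  are immediate on the whole disc, origin included.\<close>

definition theta3 :: "complex \<Rightarrow> complex" where
  "theta3 q = (qpoch_inf (- q) (q ^ 2))\<^sup>2 * euler_prod 2 q"

lemma theta_eq_theta3:
  assumes "q \<noteq> 0" "norm q < 1"
  shows "theta q (q\<^sup>2) = theta3 q"
proof -
  have "- (q\<^sup>2) / q = - q" using assms by (simp add: power2_eq_square)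
  then show ?thesis
    using jacobi_triple_product[of q "q\<^sup>2"] assms norm_power_less_1[OF assms(2), of 2]
    by (simp add: theta3_def power2_eq_square[of "qpoch_inf _ _"])
qed

section \<open>Sum and product of the two Rogers-Ramanujan expressions\<close>

text \<open>The triple product turns each series in \<open>theta_product_sum\<close> into a product.
  Writing \<open>euler_prod 1 q\<close> and \<open>euler_prod 4 q\<close> through the
  Rogers-Ramanujan products then lets \<open>euler_prod 5 q\<close> and
  \<open>euler_prod 20 q\<close> cancel.\<close>

lemma rogers_ramanujan_sum:
  assumes "q \<noteq> 0" "norm q < 1"
  shows "euler_prod 2 q / (rr_G_rec q * rr_G_rec (q ^ 4)) + q * euler_prod 2 q / (rr_H_rec q * rr_H_rec (q ^ 4))
    = theta3 q"
proof -
  note pow = norm_power_less_1[OF assms(2)]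
  let ?g = "rr_G_rec q" and ?g4 = "rr_G_rec (q ^ 4)" and ?h = "rr_H_rec q" and ?h4 = "rr_H_rec (q ^ 4)"
  let ?a = "qpoch_inf (- q) q" and ?b = "qpoch_inf (q ^ 2) (q ^ 4)"
  have nz: "?g \<noteq> 0" "?g4 \<noteq> 0" "?h \<noteq> 0" "?h4 \<noteq> 0"
    using rr_rec_nonzero[OF assms(2)] rr_rec_nonzero[OF pow[of 4]] by auto
  \<comment> \<open>Separating even and odd indices in \<open>?a\<close> leaves a factor that
    Euler's theorem, applied at \<open>q ^ 2\<close>, cancels against \<open>?b\<close>.\<close>
  have ab: "?a * ?b = qpoch_inf (- q) (q ^ 2)"
  proof -
    have "?a = qpoch_inf (- q) (q ^ 2) * qpoch_inf (- (q ^ 2)) (q ^ 2)"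
      using qpoch_inf_split_2[OF assms(2), of "- q"] by (simp add: power2_eq_square)
    moreover have "qpoch_inf (- (q ^ 2)) (q ^ 2) * ?b = 1"
      using euler_distinct_odd[OF pow[of 2]] by simp
    ultimately show ?thesis by (simp add: mult.assoc)
  qed
  \<comment> \<open>The 2 stems from the factor of index 0 in \<open>qpoch_inf (- 1) q\<close>; it
    cancels the 2 in \<open>theta_product_sum\<close>.\<close>
  have "theta q q = 2 * ?a\<^sup>2 * euler_prod 1 q"
    using jacobi_triple_product[of q q] qpoch_inf_minus_one[OF assms(2)] assms by (simp add: power2_eq_square)
  moreover have "theta (- (q ^ 2)) (q ^ 4) = ?b\<^sup>2 * euler_prod 4 q"
  proof -
    have "- (q ^ 4) / - (q ^ 2) = q ^ 2" using assms by (simp add: field_simps)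
    then show ?thesis
      using jacobi_triple_product[of "- (q ^ 2)" "q ^ 4"] pow[of 4] assms by (simp add: power2_eq_square)
  qed
  moreover have "theta (- (q ^ 3)) (q ^ 5) = ?h * euler_prod 5 q"
  proof -
    have "- (q ^ 5) / - (q ^ 3) = q ^ 2" using assms by (simp add: field_simps)
    then show ?thesis
      using jacobi_triple_product[of "- (q ^ 3)" "q ^ 5"] pow[of 5] assms by (simp add: rr_H_rec_def)
  qed
  moreover have "theta (- (q ^ 12)) (q ^ 20) = ?h4 * euler_prod 20 q"
  proof -
    have "- (q ^ 20) / - (q ^ 12) = q ^ 8" using assms by (simp add: field_simps)
    then show ?thesis
      using jacobi_triple_product[of "- (q ^ 12)" "q ^ 20"] pow[of 20] assms by (simp add: rr_H_rec_def)
  qed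
  moreover have "theta (- (q ^ 4)) (q ^ 5) = ?g * euler_prod 5 q"
  proof -
    have "- (q ^ 5) / - (q ^ 4) = q" using assms by (simp add: numeral_eq_Suc)
    then show ?thesis
      using jacobi_triple_product[of "- (q ^ 4)" "q ^ 5"] pow[of 5] assms by (simp add: rr_G_rec_def)
  qed
  moreover have "theta (- (q ^ 16)) (q ^ 20) = ?g4 * euler_prod 20 q"
  proof -
    have "- (q ^ 20) / - (q ^ 16) = q ^ 4" using assms by (simp add: field_simps)
    then show ?thesis
      using jacobi_triple_product[of "- (q ^ 16)" "q ^ 20"] pow[of 20] assms by (simp add: rr_G_rec_def)
  qed
  moreover have "euler_prod 1 q = ?g * ?h * euler_prod 5 q"
    using rr_rec_product[OF assms(2)] by simp
  moreover have "euler_prod 4 q = ?g4 * ?h4 * euler_prod 20 q"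
    using rr_rec_product[OF pow[of 4]] by simp
  ultimately have "2 * ?a\<^sup>2 * (?g * ?h * euler_prod 5 q) * (?b\<^sup>2 * (?g4 * ?h4 * euler_prod 20 q))
      = 2 * (?h * euler_prod 5 q * (?h4 * euler_prod 20 q) + q * (?g * euler_prod 5 q * (?g4 * euler_prod 20 q)))"
    using theta_product_sum[OF assms] by simp
  then have "(2 * euler_prod 5 q * euler_prod 20 q) * ((?a * ?b)\<^sup>2 * (?g * ?g4 * (?h * ?h4)))
      = (2 * euler_prod 5 q * euler_prod 20 q) * (?h * ?h4 + q * (?g * ?g4))"
    by (simp add: algebra_simps)
  then have "(?a * ?b)\<^sup>2 * (?g * ?g4 * (?h * ?h4)) = ?h * ?h4 + q * (?g * ?g4)"
    using euler_prod_nonzero[OF assms(2)] by simp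
  moreover have "euler_prod 2 q / (?g * ?g4) + q * euler_prod 2 q / (?h * ?h4)
      = (?h * ?h4 + q * (?g * ?g4)) * euler_prod 2 q / (?g * ?g4 * (?h * ?h4))"
    using nz by (simp add: field_simps)
  moreover have "c * d * e / d = c * e" if "d \<noteq> 0" for c d e :: complex
    using that by simp
  ultimately show ?thesis
    unfolding theta3_def ab[symmetric] using nz by (metis no_zero_divisors)
qed

text \<open>Both sides equal 4 q f(q, q^9) f(q^3, q^7) in Ramanujan's notation: the left one by
  relations among Euler products, the right one by \<open>theta_square_diff\<close>.\<close>

lemma rogers_ramanujan_product:
  assumes "q \<noteq> 0" "norm q < 1"
  shows "4 * (euler_prod 2 q / (rr_G_rec q * rr_G_rec (q ^ 4))) * (q * euler_prod 2 q / (rr_H_rec q * rr_H_rec (q ^ 4)))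
    = (theta3 q)\<^sup>2 - (theta3 (q ^ 5))\<^sup>2"
proof -
  note pow = norm_power_less_1[OF assms(2)]
  let ?g = "rr_G_rec q" and ?g4 = "rr_G_rec (q ^ 4)" and ?h = "rr_H_rec q" and ?h4 = "rr_H_rec (q ^ 4)"
  have nz: "?g \<noteq> 0" "?g4 \<noteq> 0" "?h \<noteq> 0" "?h4 \<noteq> 0"
    using rr_rec_nonzero[OF assms(2)] rr_rec_nonzero[OF pow[of 4]] by auto
  let ?P = "\<lambda>k. qpoch_inf (- (q ^ k)) (q ^ 10)"
  let ?p = "qpoch_inf (- q) (q ^ 2)"
  have E: "euler_prod k q \<noteq> 0" if "k > 0" for k using euler_prod_nonzero[OF assms(2) that] .
  have "theta q (q ^ 10) = ?P 1 * ?P 9 * euler_prod 10 q"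
  proof -
    have "- (q ^ 10) / q = - (q ^ 9)" using assms by (simp add: numeral_eq_Suc)
    then show ?thesis using jacobi_triple_product[of q "q ^ 10"] pow[of 10] assms by simp
  qed
  moreover have "theta (q ^ 3) (q ^ 10) = ?P 3 * ?P 7 * euler_prod 10 q"
  proof -
    have "- (q ^ 10) / q ^ 3 = - (q ^ 7)" using assms by (simp add: field_simps)
    then show ?thesis using jacobi_triple_product[of "q ^ 3" "q ^ 10"] pow[of 10] assms by simp
  qed
  moreover have p: "?p = ?P 1 * ?P 3 * ?P 5 * ?P 7 * ?P 9"
    using qpoch_inf_split_5[OF pow[of 2], of "- q"] by (simp add: numeral_eq_Suc mult_ac)
  \<comment> \<open>The factor \<open>?P 5\<close> completes the other four to \<open>?p\<close>;
    being nonzero, it is cancelled again below.\<close>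
  ultimately have 1: "?P 5 * (theta q (q ^ 10) * theta (q ^ 3) (q ^ 10)) = ?p * (euler_prod 10 q)\<^sup>2"
    by (simp add: power2_eq_square mult_ac)
  have 2: "?P 5 * euler_prod 5 q * euler_prod 20 q = (euler_prod 10 q)\<^sup>2"
    using qpoch_inf_odd_product[OF pow[of 5]] by simp
  have 3: "?p * euler_prod 1 q * euler_prod 4 q = (euler_prod 2 q)\<^sup>2"
    by (rule qpoch_inf_odd_product[OF assms(2)])
  have P5: "?P 5 \<noteq> 0" using 2 E[of 10] by auto
  have "?P 5 * (theta q (q ^ 10) * theta (q ^ 3) (q ^ 10)) = ?P 5 * (?p * euler_prod 5 q * euler_prod 20 q)"
    unfolding 1 2[symmetric] by (simp add: mult_ac)
  then have 4: "theta q (q ^ 10) * theta (q ^ 3) (q ^ 10) = ?p * euler_prod 5 q * euler_prod 20 q"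
    using P5 by simp
  have 5: "euler_prod 1 q = ?g * ?h * euler_prod 5 q"
    using rr_rec_product[OF assms(2)] by simp
  have 6: "euler_prod 4 q = ?g4 * ?h4 * euler_prod 20 q"
    using rr_rec_product[OF pow[of 4]] by simp
  have "(euler_prod 2 q)\<^sup>2 = ?p * euler_prod 5 q * euler_prod 20 q * (?g * ?g4 * (?h * ?h4))"
    unfolding 3[symmetric] 5 6 by (simp add: mult_ac)
  then have "4 * (euler_prod 2 q / (?g * ?g4)) * (q * euler_prod 2 q / (?h * ?h4))
      = 4 * q * (theta q (q ^ 10) * theta (q ^ 3) (q ^ 10))"
    unfolding 4 using nz by (simp add: field_simps power2_eq_square)
  also have "\<dots> = (theta q (q\<^sup>2))\<^sup>2 - (theta (q ^ 5) (q ^ 10))\<^sup>2"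
    by (rule theta_square_diff[OF assms, symmetric])
  also have "theta (q ^ 5) (q ^ 10) = theta3 (q ^ 5)"
    using theta_eq_theta3[of "q ^ 5"] assms pow[of 5] by simp
  finally show ?thesis using theta_eq_theta3[OF assms] by simp
qed

section \<open>Determination of the sign\<close>

lemma qpoch_inf_0_left [simp]: "qpoch_inf 0 q = 1"
  by (simp add: qpoch_inf_def)

lemma theta3_nonzero:
  assumes "norm q < 1"
  shows "theta3 q \<noteq> 0"
  unfolding theta3_def using assms norm_power_less_1[OF assms, of 2] by (simp add: qpoch_inf_nonzero)

text \<open>Sum and product fix the difference only up to a sign that might depend on
  \<open>q\<close>. The normalised difference \<open>R\<close> is continuous with finite range on
  the connected disc, hence constant, and its value at 0 decides the sign.\<close>

lemma rogers_ramanujan_difference: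
  assumes "norm q < 1"
  shows "euler_prod 2 q / (rr_G_rec q * rr_G_rec (q ^ 4)) - q * euler_prod 2 q / (rr_H_rec q * rr_H_rec (q ^ 4))
    = theta3 (q ^ 5)"
proof -
  define A where "A q = euler_prod 2 q / (rr_G_rec q * rr_G_rec (q ^ 4))" for q
  define B where "B q = q * euler_prod 2 q / (rr_H_rec q * rr_H_rec (q ^ 4))" for q
  define R where "R q = (A q - B q) / theta3 (q ^ 5)" for q
  have cont: "continuous_on (ball 0 1) (\<lambda>q. qpoch_inf (q ^ a) (q ^ b))"
    "continuous_on (ball 0 1) (\<lambda>q. qpoch_inf (- (q ^ a)) (q ^ b))" if "b > 0" for a b
    using continuous_on_qpoch_inf[OF that, of 1 a] continuous_on_qpoch_inf[OF that, of "- 1" a] by simp_all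
  have cont1: "continuous_on (ball 0 1) (\<lambda>q. qpoch_inf q (q ^ b))" if "b > 0" for b
    using cont(1)[OF that, of 1] by simp
  have nz: "rr_G_rec q \<noteq> 0" "rr_G_rec (q ^ 4) \<noteq> 0" "rr_H_rec q \<noteq> 0" "rr_H_rec (q ^ 4) \<noteq> 0" "theta3 (q ^ 5) \<noteq> 0"
    if "q \<in> ball 0 1" for q
    using that rr_rec_nonzero norm_power_less_1 theta3_nonzero by simp_all
  have "continuous_on (ball 0 1) R"
    unfolding R_def A_def B_def
    by (intro continuous_intros cont; (use nz in simp)?)
      (auto simp: rr_G_rec_def rr_H_rec_def theta3_def simp flip: power_mult intro!: continuous_intros cont cont1)
  moreover have "R q \<in> {1, - 1}" if "q \<in> ball 0 1" for q
  proof (cases "q = 0")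
    case True
    \<comment> \<open>The two identities assume \<open>q \<noteq> 0\<close>. At the origin all the
      symbols involved have first argument 0 and equal 1, while the factor \<open>q\<close>
      annihilates \<open>B\<close>.\<close>
    then show ?thesis by (simp add: R_def A_def B_def rr_G_rec_def rr_H_rec_def theta3_def)
  next
    case False
    have "A q + B q = theta3 q" "4 * A q * B q = (theta3 q)\<^sup>2 - (theta3 (q ^ 5))\<^sup>2"
      using rogers_ramanujan_sum[OF False] rogers_ramanujan_product[OF False] that by (simp_all add: A_def B_def)
    moreover have "(A q - B q)\<^sup>2 = (A q + B q)\<^sup>2 - 4 * A q * B q"
      by (simp add: power2_eq_square algebra_simps)
    ultimately have "(A q - B q)\<^sup>2 = (theta3 (q ^ 5))\<^sup>2" by simp
    then have "A q - B q = theta3 (q ^ 5) \<or> A q - B q = - theta3 (q ^ 5)" by (simp add: power2_eq_iff)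
    then show ?thesis using nz(5)[OF that] by (auto simp: R_def)
  qed
  then have "R ` ball 0 1 \<subseteq> {1, - 1}" by (rule image_subsetI)
  then have "finite (R ` ball 0 1)" by (rule finite_subset) simp
  ultimately have "R constant_on ball 0 1"
    by (intro continuous_finite_range_constant convex_connected convex_ball)
  moreover have "R 0 = 1" by (simp add: R_def A_def B_def rr_G_rec_def rr_H_rec_def theta3_def)
  ultimately have "R q = 1"
    using assms unfolding constant_on_def by (metis mem_ball_0 norm_zero zero_less_one)
  then show ?thesis using nz(5)[of q] assms by (simp add: R_def A_def B_def)
qed

section \<open>Return to the one-sided series and the quotient\<close>

text \<open>The terms at k and -k of the bilateral series coincide and the central term is
  1.\<close>

lemma theta3_sums:
  assumes "q \<noteq> 0" "norm q < 1"
  shows "(\<lambda>n. q ^ (Suc n)\<^sup>2) sums ((theta3 q - 1) / 2)"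
proof -
  have sq: "theta_term q (q\<^sup>2) k = q powi (k * k)" for k
    using theta_term_power[of q "k * k" 1 k 2] assms by simp
  have "int n * int n = int (n\<^sup>2)" for n by (simp add: power2_eq_square)
  then have t: "theta_term q (q\<^sup>2) (int n) = q ^ n\<^sup>2" "theta_term q (q\<^sup>2) (- int n) = q ^ n\<^sup>2" for n
    by (simp_all only: sq minus_mult_minus power_int_of_nat)
  have T: "(theta_term q (q\<^sup>2) has_sum theta3 q) UNIV"
    using has_sum_theta[of q "q\<^sup>2"] assms norm_power_less_1[of q 2] by (simp add: theta_eq_theta3)
  define S where "S = infsum (theta_term q (q\<^sup>2)) (range (\<lambda>n. int (Suc n)))"
  have pos: "(theta_term q (q\<^sup>2) has_sum S) (range (\<lambda>n. int (Suc n)))"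
    unfolding S_def using summable_on_subset_banach[OF has_sum_imp_summable[OF T]] by simp
  then have N: "((\<lambda>n. q ^ (Suc n)\<^sup>2) has_sum S) UNIV"
    by (subst (asm) has_sum_reindex) (simp_all add: o_def inj_on_def t del: of_nat_Suc)
  then have neg: "(theta_term q (q\<^sup>2) has_sum S) (range (\<lambda>n. - int (Suc n)))"
    by (subst has_sum_reindex) (simp_all add: o_def inj_on_def t del: of_nat_Suc)
  have "(theta_term q (q\<^sup>2) has_sum (1 + (S + S))) ({0} \<union> (range (\<lambda>n. int (Suc n)) \<union> range (\<lambda>n. - int (Suc n))))"
    by (intro has_sum_Un_disjoint pos neg has_sum_finiteI) auto
  moreover have "k \<in> {0} \<union> (range (\<lambda>n. int (Suc n)) \<union> range (\<lambda>n. - int (Suc n)))" for k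
  proof -
    consider "k = 0" | "k = int (Suc (nat (k - 1)))" | "k = - int (Suc (nat (- k - 1)))" by linarith
    then show ?thesis by cases blast+
  qed
  then have "{0} \<union> (range (\<lambda>n. int (Suc n)) \<union> range (\<lambda>n. - int (Suc n))) = UNIV" by blast
  ultimately have "theta3 q = 1 + (S + S)" using T has_sum_unique by metis
  then have "S = (theta3 q - 1) / 2" by simp
  with N show ?thesis using has_sum_imp_sums by metis
qed

text \<open>Splitting \<open>euler_prod 2 q\<close> into exponent classes modulo 10, and the classes
  2 and 8 further modulo 20, exposes \<open>?Q 8 * ?Q 12\<close>, which is exactly
  \<open>rr_H_rec (q ^ 4)\<close> and cancels.\<close>

lemma quintuple_quotient_eq:
  assumes "norm q < 1"
  shows "qpochs_inf [q ^ 4, q ^ 6, q ^ 10] (q ^ 10) * qpochs_inf [q ^ 2, q ^ 18] (q ^ 20) / qpochs_inf [q ^ 2, q ^ 3] (q ^ 5)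
    = euler_prod 2 q / (rr_H_rec q * rr_H_rec (q ^ 4))"
proof -
  note pow = norm_power_less_1[OF assms]
  let ?P = "\<lambda>k. qpoch_inf (q ^ k) (q ^ 10)" and ?Q = "\<lambda>k. qpoch_inf (q ^ k) (q ^ 20)"
  have "euler_prod 2 q = ?P 2 * ?P 4 * ?P 6 * ?P 8 * ?P 10"
    using qpoch_inf_split_5[OF pow[of 2], of "q ^ 2"] by (simp flip: power_mult power_add)
  moreover have "?P 2 = ?Q 2 * ?Q 12" "?P 8 = ?Q 8 * ?Q 18"
    using qpoch_inf_split_2[OF pow[of 10], of "q ^ 2"] qpoch_inf_split_2[OF pow[of 10], of "q ^ 8"]
    by (simp_all flip: power_mult power_add)
  moreover have "rr_H_rec (q ^ 4) = ?Q 8 * ?Q 12" by (simp add: rr_H_rec_def flip: power_mult)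
  moreover have "?Q 8 \<noteq> 0" "?Q 12 \<noteq> 0" using pow by (simp_all add: qpoch_inf_nonzero)
  ultimately show ?thesis by (simp add: qpochs_inf_def rr_H_rec_def)
qed

theorem theorem20:
  fixes q :: complex
  assumes "norm q < 1"
  shows "(\<lambda>n. q ^ ((Suc n)\<^sup>2 - 1) - q ^ (5 * (Suc n)\<^sup>2 - 1)) sums
           (qpochs_inf [q ^ 4, q ^ 6, q ^ 10] (q ^ 10) * qpochs_inf [q ^ 2, q ^ 18] (q ^ 20)
             / qpochs_inf [q ^ 2, q ^ 3] (q ^ 5))"
proof (cases "q = 0")
  case True
  \<comment> \<open>Since \<open>0 ^ 0 = 1\<close>, at \<open>q = 0\<close> only the leading power
    of the term \<open>n = 0\<close> survives, and the quotient of products is 1.\<close>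
  have "5 * (Suc n)\<^sup>2 - 1 > 0" "(Suc n)\<^sup>2 - 1 = 0 \<longleftrightarrow> n = 0" for n
    by (simp_all add: power2_eq_square)
  then have "(\<lambda>n. q ^ ((Suc n)\<^sup>2 - 1) - q ^ (5 * (Suc n)\<^sup>2 - 1)) = (\<lambda>n. if n = 0 then 1 else 0)"
    unfolding True fun_eq_iff power_0_left by (simp add: not_le)
  then show ?thesis
    using sums_single[of 0 "\<lambda>_. 1 :: complex"] True by (simp add: qpochs_inf_def)
next
  case False
  let ?R = "euler_prod 2 q / (rr_H_rec q * rr_H_rec (q ^ 4))"
  have q5: "q ^ 5 \<noteq> 0" "norm (q ^ 5) < 1" using False norm_power_less_1[OF assms, of 5] by auto
  \<comment> \<open>The sum identity minus the difference identity leaves twice the term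
    \<open>q * ?R\<close>.\<close>
  have "theta3 q - theta3 (q ^ 5) = 2 * (q * ?R)"
    unfolding rogers_ramanujan_sum[OF False assms, symmetric] rogers_ramanujan_difference[OF assms, symmetric]
    by simp
  then have "(theta3 q - 1) / 2 - (theta3 (q ^ 5) - 1) / 2 = q * ?R"
    by (simp add: field_simps)
  then have "(\<lambda>n. q ^ (Suc n)\<^sup>2 - (q ^ 5) ^ (Suc n)\<^sup>2) sums (q * ?R)"
    using sums_diff[OF theta3_sums[OF False assms] theta3_sums[OF q5]] by simp
  then have "(\<lambda>n. (q ^ (Suc n)\<^sup>2 - (q ^ 5) ^ (Suc n)\<^sup>2) / q) sums (q * ?R / q)"
    by (rule sums_divide)
  \<comment> \<open>Both exponents are at least 1, so the truncated subtraction of natural numbers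
    is exact.\<close>
  moreover have "(q ^ (Suc n)\<^sup>2 - (q ^ 5) ^ (Suc n)\<^sup>2) / q = q ^ ((Suc n)\<^sup>2 - 1) - q ^ (5 * (Suc n)\<^sup>2 - 1)" for n
    using False by (simp add: diff_divide_distrib power_diff flip: power_mult del: power_Suc)
  ultimately show ?thesis
    unfolding quintuple_quotient_eq[OF assms] using False by simp
qed

end
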